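(* Let $p$ be a prime, let $\theta$ be a generator of the multiplicative group modulo $p$, and let $\mathcal{K}$ be any subset of $\{1,2,\dots,p-1\}$. Then $\mathrm{Ruzsa}(p,\theta,\mathcal{K})$ is a subset of $\mathbb{Z}_{p^2-p}$ with cardinality $|\mathcal{K}|(p-1)$, and $$\|\mathrm{Ruzsa}(p,\theta,\mathcal{K})\ast \mathrm{Ruzsa}(p,\theta,\mathcal{K})\|_\infty\le 2|\mathcal{K}|^2.$$
   Context: $\mathbb{Z}_n$ denotes the integers modulo $n$. For $S\subseteq\mathbb{Z}_n$ and $m\in\mathbb{Z}_n$, let $S\ast S(m)=|\{(s_1,s_2): s_1,s_2\in S,\ s_1+s_2=m\}|$ (ordered pairs, addition in $\mathbb{Z}_n$), and $\|S\ast S\|_\infty=\max_{m\in\mathbb{Z}_n}S\ast S(m)$. For $p$ prime and $\theta$ a generator of the multiplicative group modulo $p$, and for $1\le i<p$ and an integer $t$, let $a_{t,i}$ be the congruence class modulo $p^2-p$ defined by $a_{t,i}\equiv t \pmod{p-1}$ and $a_{t,i}\equiv i\theta^t \pmod p$. For $1\le k<p$ set $\mathrm{Ruzsa}(p,\theta,k)=\{a_{t,k} : 1\le t<p\}\subseteq\mathbb{Z}_{p^2-p}$, and for $\mathcal{K}\subseteq\{1,\dots,p-1\}$ set $\mathrm{Ruzsa}(p,\theta,\mathcal{K})=\bigcup_{k\in\mathcal{K}}\mathrm{Ruzsa}(p,\theta,k)$. *)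

theory Defs
  imports "HOL-Number_Theory.Number_Theory" "HOL-Algebra.Generated_Groups"
begin

text \<open>
  The integers modulo \<open>n\<close> are the library's \<^const>\<open>residue_ring\<close> \<open>n\<close>, whose carrier is the set
  \<open>{0..n - 1}\<close> of canonical representatives.  All definitions below are meant for \<open>n \<ge> 1\<close>.
\<close>

definition self_conv :: "int \<Rightarrow> int set \<Rightarrow> int \<Rightarrow> nat" where
  "self_conv n S m = card {(s1, s2). s1 \<in> S \<and> s2 \<in> S \<and> s1 \<oplus>\<^bsub>residue_ring n\<^esub> s2 = m}"

definition self_conv_norm :: "int \<Rightarrow> int set \<Rightarrow> nat" where
  "self_conv_norm n S = Max (self_conv n S ` carrier (residue_ring n))"

definition unit_group_mod :: "int \<Rightarrow> int monoid" where
  "unit_group_mod p = units_of (residue_ring p)"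

definition generator_mod :: "int \<Rightarrow> int \<Rightarrow> bool" where
  "generator_mod p \<theta> \<longleftrightarrow>
     \<theta> \<in> carrier (unit_group_mod p) \<and>
     generate (unit_group_mod p) {\<theta>} = carrier (unit_group_mod p)"

text \<open>
  \<open>ruzsa_class p \<theta> t i\<close> is the class \<open>a\<^bsub>t,i\<^esub>\<close> modulo \<open>p\<^sup>2 - p\<close>.  The exponent \<open>t\<close> is an arbitrary
  integer, so the power of \<open>\<theta>\<close> is the one of the group of units modulo \<open>p\<close>.
\<close>

definition ruzsa_class :: "int \<Rightarrow> int \<Rightarrow> int \<Rightarrow> int \<Rightarrow> int" where
  "ruzsa_class p \<theta> t i =
     (THE a. a \<in> carrier (residue_ring (p\<^sup>2 - p)) \<and>
             [a = t] (mod (p - 1)) \<and>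
             [a = i * (\<theta> [^]\<^bsub>unit_group_mod p\<^esub> t)] (mod p))"

lemma ruzsa_class_ex1:
  fixes p :: int
  assumes "p > 1"
  shows "\<exists>!a. a \<in> carrier (residue_ring (p\<^sup>2 - p)) \<and> [a = u] (mod (p - 1)) \<and> [a = v] (mod p)"
proof -
  have cop: "coprime (p - 1) p"
    by simp
  have eq: "p\<^sup>2 - p = (p - 1) * p"
    by (simp add: power2_eq_square algebra_simps)
  have pos: "(p - 1) * p > 0"
    using assms by simp
  have carr: "carrier (residue_ring (p\<^sup>2 - p)) = {0..<(p - 1) * p}"
    unfolding eq by (auto simp: residue_ring_def)
  obtain x where x: "[x = u] (mod (p - 1))" "[x = v] (mod p)"
    using binary_chinese_remainder_int[OF cop] by blast
  let ?a = "x mod ((p - 1) * p)"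
  have "[?a = x] (mod (p - 1))" "[?a = x] (mod p)"
    by (simp_all add: cong_def mod_mod_cancel)
  then have a: "[?a = u] (mod (p - 1))" "[?a = v] (mod p)"
    using x cong_trans by blast+
  show ?thesis
  proof (rule ex1I[of _ ?a])
    show "?a \<in> carrier (residue_ring (p\<^sup>2 - p)) \<and> [?a = u] (mod (p - 1)) \<and> [?a = v] (mod p)"
      using a pos by (simp add: carr)
  next
    fix b
    assume b: "b \<in> carrier (residue_ring (p\<^sup>2 - p)) \<and> [b = u] (mod (p - 1)) \<and> [b = v] (mod p)"
    have "[b = ?a] (mod (p - 1))" "[b = ?a] (mod p)"
      using a b cong_trans cong_sym by blast+
    then have "[b = ?a] (mod ((p - 1) * p))"
      using cop by (rule coprime_cong_mult)
    then show "b = ?a"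
      using b by (simp add: carr cong_def)
  qed
qed

definition ruzsa :: "int \<Rightarrow> int \<Rightarrow> int \<Rightarrow> int set" where
  "ruzsa p \<theta> k = (\<lambda>t. ruzsa_class p \<theta> t k) ` {1..<p}"

definition ruzsa_union :: "int \<Rightarrow> int \<Rightarrow> int set \<Rightarrow> int set" where
  "ruzsa_union p \<theta> K = (\<Union>k\<in>K. ruzsa p \<theta> k)"

end

theory Submission
  imports Defs
begin

text \<open>
  Write \<open>R\<^sub>k\<close> for the Ruzsa set with parameter \<open>k\<close>. Every \<open>a \<in> R\<^sub>k\<close> satisfies
  \<open>a \<equiv> k \<theta>\<^sup>a (mod p)\<close>, because \<open>\<theta>\<^sup>t\<close> depends only on \<open>t\<close> modulo \<open>p - 1\<close>. Since \<open>\<theta>\<close> has order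
  \<open>p - 1\<close>, an element of \<open>R\<^sub>k\<close> is determined by its residue modulo \<open>p\<close>
  (\<open>ruzsa_cong_imp_eq\<close>), and the pair \<open>(k, t)\<close> is determined by the class \<open>a\<^bsub>t,k\<^esub>\<close>
  (\<open>inj_on_ruzsa_class\<close>), which gives the cardinality.

  For the convolution, fix \<open>j, k \<in> K\<close> and consider the pairs \<open>(x, y) \<in> R\<^sub>j \<times> R\<^sub>k\<close> with sum \<open>m\<close>
  modulo \<open>p\<^sup>2 - p\<close>. Modulo \<open>p\<close> the sum \<open>x + y\<close> is \<open>m\<close> and the product \<open>x y\<close> is
  \<open>j k \<theta>\<^sup>x\<^sup>+\<^sup>y = j k \<theta>\<^sup>m\<close>, so \<open>x\<close> is a root modulo \<open>p\<close> of a quadratic polynomial that does not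
  depend on the pair. Hence \<open>x\<close> has at most two residues modulo \<open>p\<close>, and there are at most
  two such pairs (\<open>card_ruzsa_sum_pairs_le_2\<close>). Summing over the \<open>|K|\<^sup>2\<close> choices of \<open>(j, k)\<close>
  gives the bound.
\<close>

text \<open>
  A prime modulus together with a generator of its group of units. The integer power of \<open>\<theta>\<close> in
  that group is abbreviated to \<open>E\<close>; its values are representatives in \<open>{1..p - 1}\<close>.
\<close>

locale prime_generator =
  fixes p \<theta> :: int
  assumes prime_p: "prime p"
    and gen: "generator_mod p \<theta>"
begin

abbreviation E :: "int \<Rightarrow> int" where
  "E t \<equiv> \<theta> [^]\<^bsub>unit_group_mod p\<^esub> t"

lemma p_gt_1: "p > 1"
  using prime_p by (rule prime_gt_1_int)

lemma residues_p: "residues p"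
  using p_gt_1 by unfold_locales

lemma group_units: "group (unit_group_mod p)"
proof -
  interpret residues p "residue_ring p" by (rule residues_p) simp
  show ?thesis unfolding unit_group_mod_def by (rule units_group)
qed

lemma carrier_units: "carrier (unit_group_mod p) = {1..p - 1}"
proof -
  interpret residues p "residue_ring p" by (rule residues_p) simp
  have "coprime x p" if "0 < x" "x < p" for x
    using that prime_p by (metis coprime_commute prime_imp_coprime zdvd_not_zless)
  then show ?thesis
    unfolding unit_group_mod_def units_of_carrier res_units_eq by auto
qed

lemma E_in: "E t \<in> {1..p - 1}"
  using group.int_pow_closed[OF group_units] gen
  by (metis carrier_units generator_mod_def)

lemma E_add: "[E (s + t) = E s * E t] (mod p)"
proof -
  interpret residues p "residue_ring p" by (rule residues_p) simp
  have "E (s + t) = E s \<otimes>\<^bsub>unit_group_mod p\<^esub> E t"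
    using gen unfolding generator_mod_def by (blast intro: group.int_pow_mult[OF group_units])
  then show ?thesis
    by (simp add: unit_group_mod_def units_of_mult res_mult_eq)
qed

lemma E_eq_iff: "E s = E t \<longleftrightarrow> [s = t] (mod (p - 1))"
proof -
  have \<theta>: "\<theta> \<in> carrier (unit_group_mod p)"
    using gen by (simp add: generator_mod_def)
  have "group.ord (unit_group_mod p) \<theta> = card (carrier (unit_group_mod p))"
    using group.generate_pow_card[OF group_units \<theta>] gen by (simp add: generator_mod_def)
  then have "int (group.ord (unit_group_mod p) \<theta>) = p - 1"
    using p_gt_1 by (simp add: carrier_units)
  then show ?thesis
    using group.int_pow_eq[OF group_units \<theta>] by (simp add: cong_iff_dvd_diff dvd_diff_commute)
qed

lemma not_p_dvd: "k \<in> {1..p - 1} \<Longrightarrow> \<not> p dvd k"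
  by (auto dest: zdvd_imp_le)

lemma cong_p_imp_eq: "a = b" if "[a = b] (mod p)" "a \<in> {1..p - 1}" "b \<in> {1..p - 1}"
  using that by (simp add: cong_def)

lemma ruzsa_class_props:
  "ruzsa_class p \<theta> t k \<in> carrier (residue_ring (p\<^sup>2 - p))"
  "[ruzsa_class p \<theta> t k = t] (mod (p - 1))"
  "[ruzsa_class p \<theta> t k = k * E t] (mod p)"
  using theI'[OF ruzsa_class_ex1[OF p_gt_1, of t "k * E t"]]
  unfolding ruzsa_class_def by blast+

lemma ruzsa_cong:
  assumes "a \<in> ruzsa p \<theta> k"
  shows "[a = k * E a] (mod p)"
proof -
  obtain t where "a = ruzsa_class p \<theta> t k"
    using assms by (auto simp: ruzsa_def)
  with ruzsa_class_props[of t k] show ?thesis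
    using E_eq_iff[of a t] by simp
qed

lemma ruzsa_subset: "ruzsa p \<theta> k \<subseteq> carrier (residue_ring (p\<^sup>2 - p))"
  using ruzsa_class_props(1) by (auto simp: ruzsa_def)

lemma carrier_modulus: "carrier (residue_ring (p\<^sup>2 - p)) = {0..<(p - 1) * p}"
  by (auto simp: residue_ring_def power2_eq_square algebra_simps)

lemma carrier_eqI:
  assumes "a \<in> carrier (residue_ring (p\<^sup>2 - p))" "b \<in> carrier (residue_ring (p\<^sup>2 - p))"
    and "[a = b] (mod (p - 1))" "[a = b] (mod p)"
  shows "a = b"
  using ruzsa_class_ex1[OF p_gt_1, of b b] assms cong_refl by blast

lemma ruzsa_cong_imp_eq:
  assumes "k \<in> {1..p - 1}" "a \<in> ruzsa p \<theta> k" "b \<in> ruzsa p \<theta> k" "[a = b] (mod p)"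
  shows "a = b"
proof -
  have "[k * E a = k * E b] (mod p)"
    using assms ruzsa_cong by (meson cong_sym cong_trans)
  moreover have "coprime k p"
    using prime_imp_coprime[OF prime_p not_p_dvd[OF assms(1)]] by (simp add: coprime_commute)
  ultimately have "[E a = E b] (mod p)"
    by (simp add: cong_mult_lcancel)
  then have "E a = E b"
    by (rule cong_p_imp_eq) (rule E_in)+
  then show ?thesis
    using assms ruzsa_subset by (auto simp: E_eq_iff intro: carrier_eqI)
qed

lemma inj_on_ruzsa_class:
  assumes "K \<subseteq> {1..p - 1}"
  shows "inj_on (\<lambda>(k, t). ruzsa_class p \<theta> t k) (K \<times> {1..<p})"
proof (rule inj_onI, clarify)
  fix k t l s
  assume k: "k \<in> K" and l: "l \<in> K" and t: "t \<in> {1..<p}" and s: "s \<in> {1..<p}"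
    and eq: "ruzsa_class p \<theta> t k = ruzsa_class p \<theta> s l"
  have ts: "[t = s] (mod (p - 1))"
    using ruzsa_class_props(2)[of t k] ruzsa_class_props(2)[of s l] eq
    by (metis cong_sym cong_trans)
  then have "(p - 1) dvd (t - s)"
    by (simp add: cong_iff_dvd_diff)
  then have "t = s"
    using t s dvd_imp_le_int[of "t - s" "p - 1"] by force
  have "[k * E t = l * E t] (mod p)"
    using ruzsa_class_props(3)[of t k] ruzsa_class_props(3)[of s l] eq \<open>t = s\<close>
    by (metis cong_sym cong_trans)
  moreover have "coprime (E t) p"
    using prime_imp_coprime[OF prime_p not_p_dvd[OF E_in]] by (simp add: coprime_commute)
  ultimately have "[k = l] (mod p)"
    by (simp add: cong_mult_rcancel)
  then have "k = l"
    using k l assms by (blast intro: cong_p_imp_eq)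
  with \<open>t = s\<close> show "k = l \<and> t = s" by simp
qed

lemma ruzsa_union_eq_image:
  "ruzsa_union p \<theta> K = (\<lambda>(k, t). ruzsa_class p \<theta> t k) ` (K \<times> {1..<p})"
  by (auto simp: ruzsa_union_def ruzsa_def)

lemma card_ruzsa_union:
  assumes "K \<subseteq> {1..p - 1}"
  shows "card (ruzsa_union p \<theta> K) = card K * nat (p - 1)"
  unfolding ruzsa_union_eq_image card_image[OF inj_on_ruzsa_class[OF assms]]
  by (simp add: card_cartesian_product)

text \<open>
  Instead of naming the quadratic polynomial, the proof compares an arbitrary pair \<open>(x, y)\<close> with
  a fixed pair \<open>(u, v)\<close>: equal sums and products force \<open>x \<equiv> u\<close> or \<open>x \<equiv> v\<close> modulo \<open>p\<close>.
\<close>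

lemma ruzsa_sum_cong_cases:
  assumes "x \<in> ruzsa p \<theta> j" "u \<in> ruzsa p \<theta> j" "y \<in> ruzsa p \<theta> k" "v \<in> ruzsa p \<theta> k"
    and sum: "[x + y = u + v] (mod (p\<^sup>2 - p))"
  shows "[x = u] (mod p) \<or> [x = v] (mod p)"
proof -
  have modulus: "p\<^sup>2 - p = (p - 1) * p"
    by (simp add: power2_eq_square algebra_simps)
  have sum_p: "[x + y = u + v] (mod p)" and sum_p1: "[x + y = u + v] (mod (p - 1))"
    using sum unfolding modulus by (auto intro: cong_dvd_modulus)
  have prod_E: "[a * b = j * k * E (a + b)] (mod p)"
    if "a \<in> ruzsa p \<theta> j" "b \<in> ruzsa p \<theta> k" for a b
  proof -
    have "[a * b = (j * E a) * (k * E b)] (mod p)"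
      using that by (intro cong_mult ruzsa_cong)
    also have "(j * E a) * (k * E b) = j * k * (E a * E b)"
      by (simp add: algebra_simps)
    also have "[j * k * (E a * E b) = j * k * E (a + b)] (mod p)"
      by (intro cong_mult cong_refl cong_sym[OF E_add])
    finally show ?thesis .
  qed
  have "E (x + y) = E (u + v)"
    using sum_p1 by (simp add: E_eq_iff)
  then have prod: "[x * y = u * v] (mod p)"
    using prod_E[of x y] prod_E[of u v] assms by (metis cong_sym cong_trans)
  have "p dvd x * ((x + y) - (u + v)) - (x * y - u * v)"
    using sum_p prod by (simp add: cong_iff_dvd_diff)
  also have "x * ((x + y) - (u + v)) - (x * y - u * v) = (x - u) * (x - v)"
    by (simp add: algebra_simps)
  finally show ?thesis
    using prime_dvd_mult_iff[OF prime_p] by (simp add: cong_iff_dvd_diff)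
qed

lemma card_ruzsa_sum_pairs_le_2:
  fixes j k m :: int
  defines "T \<equiv> {(x, y). x \<in> ruzsa p \<theta> j \<and> y \<in> ruzsa p \<theta> k \<and>
                  x \<oplus>\<^bsub>residue_ring (p\<^sup>2 - p)\<^esub> y = m}"
  assumes j: "j \<in> {1..p - 1}"
  shows "card T \<le> 2"
proof (cases "T = {}")
  case False
  then obtain u v where uv: "(u, v) \<in> T" by auto
  have sum: "[x + y = x' + y'] (mod (p\<^sup>2 - p))" if "(x, y) \<in> T" "(x', y') \<in> T" for x y x' y'
    using that by (auto simp: T_def residue_ring_def cong_def)
  have inj: "inj_on (\<lambda>(x, y). x mod p) T"
  proof (rule inj_onI, clarify)
    fix x y x' y' assume T: "(x, y) \<in> T" "(x', y') \<in> T" and "x mod p = x' mod p"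
    then have x: "x = x'"
      using ruzsa_cong_imp_eq[OF j] by (auto simp: T_def cong_def)
    then have "[y = y'] (mod (p\<^sup>2 - p))"
      using sum[OF T] by (simp add: cong_add_lcancel)
    moreover have "y \<in> {0..<p\<^sup>2 - p}" "y' \<in> {0..<p\<^sup>2 - p}"
      using T ruzsa_subset[of k] by (auto simp: T_def residue_ring_def)
    ultimately have "y = y'"
      by (simp add: cong_def)
    with x show "x = x' \<and> y = y'" by simp
  qed
  have "(\<lambda>(x, y). x mod p) ` T \<subseteq> {u mod p, v mod p}"
  proof clarsimp
    fix x y assume xy: "(x, y) \<in> T" and u: "x mod p \<noteq> u mod p"
    have "[x = u] (mod p) \<or> [x = v] (mod p)"
      by (rule ruzsa_sum_cong_cases[of x j u y k v])
        (use xy uv sum[OF xy uv] in \<open>auto simp: T_def\<close>)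
    then show "x mod p = v mod p"
      using u by (simp add: cong_def)
  qed
  then have "card ((\<lambda>(x, y). x mod p) ` T) \<le> card {u mod p, v mod p}"
    by (intro card_mono) auto
  also have "\<dots> \<le> 2"
    by (simp add: card_insert_if)
  finally show ?thesis
    by (simp add: card_image[OF inj])
qed simp

lemma self_conv_ruzsa_union_le:
  assumes K: "K \<subseteq> {1..p - 1}"
  shows "self_conv (p\<^sup>2 - p) (ruzsa_union p \<theta> K) m \<le> 2 * (card K)\<^sup>2"
proof -
  define T where "T = (\<lambda>(j, k). {(x, y). x \<in> ruzsa p \<theta> j \<and> y \<in> ruzsa p \<theta> k \<and>
                        x \<oplus>\<^bsub>residue_ring (p\<^sup>2 - p)\<^esub> y = m})"
  have "finite K"
    using K finite_subset by blast
  have "{(x, y). x \<in> ruzsa_union p \<theta> K \<and> y \<in> ruzsa_union p \<theta> K \<and>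
          x \<oplus>\<^bsub>residue_ring (p\<^sup>2 - p)\<^esub> y = m} = (\<Union>i\<in>K \<times> K. T i)"
    by (auto simp: T_def ruzsa_union_def)
  then have "self_conv (p\<^sup>2 - p) (ruzsa_union p \<theta> K) m = card (\<Union>i\<in>K \<times> K. T i)"
    by (simp add: self_conv_def)
  also have "\<dots> \<le> (\<Sum>i\<in>K \<times> K. card (T i))"
    using \<open>finite K\<close> by (intro card_UN_le) simp
  also have "\<dots> \<le> (\<Sum>i\<in>K \<times> K. 2)"
    using K card_ruzsa_sum_pairs_le_2 by (intro sum_mono) (auto simp: T_def)
  also have "\<dots> = 2 * (card K)\<^sup>2"
    by (simp add: card_cartesian_product power2_eq_square)
  finally show ?thesis .
qed

lemma self_conv_norm_ruzsa_union_le: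
  assumes "K \<subseteq> {1..p - 1}"
  shows "self_conv_norm (p\<^sup>2 - p) (ruzsa_union p \<theta> K) \<le> 2 * (card K)\<^sup>2"
  unfolding self_conv_norm_def carrier_modulus
  using p_gt_1 self_conv_ruzsa_union_le[OF assms] by (subst Max_le_iff) auto

end

theorem mainTheorem5:
  fixes p \<theta> :: int and K :: "int set"
  assumes "prime p"
    and "generator_mod p \<theta>"
    and "K \<subseteq> {1..p - 1}"
  shows "ruzsa_union p \<theta> K \<subseteq> carrier (residue_ring (p\<^sup>2 - p)) \<and>
         card (ruzsa_union p \<theta> K) = card K * nat (p - 1) \<and>
         self_conv_norm (p\<^sup>2 - p) (ruzsa_union p \<theta> K) \<le> 2 * (card K)\<^sup>2"
proof -
  interpret prime_generator p \<theta>
    using assms(1,2) by unfold_locales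
  have "ruzsa_union p \<theta> K \<subseteq> carrier (residue_ring (p\<^sup>2 - p))"
    using ruzsa_subset by (auto simp: ruzsa_union_def)
  then show ?thesis
    using card_ruzsa_union self_conv_norm_ruzsa_union_le assms(3) by blast
qed

end
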